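(* Any cycle graph $C_n$ ($n\ge3$) is $2$-metric antidimensional.
   Context: Graphs are finite and simple; $d_G(u,v)$ is the length of a shortest path between $u$ and $v$. For an ordered set $S=\{u_1,\dots,u_t\}\subseteq V(G)$ ($t\ge1$) and $v\in V(G)$, let $r(v|S)=(d_G(v,u_1),\dots,d_G(v,u_t))$. A nonempty proper subset $S\subset V(G)$ is a $k$-antiresolving set if $k$ is the greatest positive integer such that for every $v\in V(G)-S$ there exist at least $k-1$ different vertices $v_1,\dots,v_{k-1}\in V(G)-S$, all different from $v$, with $r(v|S)=r(v_1|S)=\cdots=r(v_{k-1}|S)$. A connected graph $G$ is $k$-metric antidimensional if $k$ is the largest integer such that $G$ contains a $k$-antiresolving set. *)

theory Defs
  imports "Graph_Theory.Graph_Theory"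
begin

text \<open>
  A finite simple graph is a \<^locale>\<open>graph\<close>: a finite, loop-free, symmetric digraph
  without parallel arcs, each undirected edge being a pair of opposite arcs.
\<close>

text \<open>
  With all arc costs 1 the library's shortest-path cost is the least number of edges
  of a walk, and it is attained by a path.
\<close>

definition graph_dist :: "('a, 'b) pre_digraph \<Rightarrow> 'a \<Rightarrow> 'a \<Rightarrow> ereal" where
  "graph_dist G u v = wf_digraph.\<mu> G (\<lambda>_. 1) u v"

text \<open>An ordered set of vertices is a distinct list of vertices.\<close>

definition metric_rep :: "('a, 'b) pre_digraph \<Rightarrow> 'a list \<Rightarrow> 'a \<Rightarrow> ereal list" where
  "metric_rep G us v = map (\<lambda>u. graph_dist G v u) us"

definition twins_at_least :: "('a, 'b) pre_digraph \<Rightarrow> 'a list \<Rightarrow> nat \<Rightarrow> bool" where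
  "twins_at_least G us k \<longleftrightarrow>
     (\<forall>v \<in> verts G - set us.
        k - 1 \<le> card {w \<in> verts G - set us. w \<noteq> v \<and> metric_rep G us w = metric_rep G us v})"

definition antiresolving_set :: "('a, 'b) pre_digraph \<Rightarrow> nat \<Rightarrow> 'a list \<Rightarrow> bool" where
  "antiresolving_set G k us \<longleftrightarrow>
     distinct us \<and> us \<noteq> [] \<and> set us \<subset> verts G \<and>
     1 \<le> k \<and> twins_at_least G us k \<and> (\<forall>j \<ge> 1. twins_at_least G us j \<longrightarrow> j \<le> k)"

definition metric_antidimensional :: "('a, 'b) pre_digraph \<Rightarrow> nat \<Rightarrow> bool" where
  "metric_antidimensional G k \<longleftrightarrow>
     graph G \<and> connected G \<and>
     (\<exists>us. antiresolving_set G k us) \<and>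
     (\<forall>j us. antiresolving_set G j us \<longrightarrow> j \<le> k)"

text \<open>
  The vertices of a cycle graph can be enumerated as \<open>f 0, \<dots>, f (n - 1)\<close>
  so that adjacency is being cyclically consecutive; this covers every isomorphic copy.
\<close>

definition cycle_graph :: "nat \<Rightarrow> ('a, 'b) pre_digraph \<Rightarrow> bool" where
  "cycle_graph n G \<longleftrightarrow>
     graph G \<and>
     (\<exists>f. bij_betw f {..<n} (verts G) \<and>
          arcs_ends G = {(f i, f j) | i j. i < n \<and> j < n \<and>
                           (j = (i + 1) mod n \<or> i = (j + 1) mod n)})"

lemma cycle_graph_standard:
  assumes "n \<ge> 3"
  shows "cycle_graph n (with_proj \<lparr>pverts = {..<n},
           parcs = {(i, j). i < n \<and> j < n \<and> (j = (i + 1) mod n \<or> i = (j + 1) mod n)}\<rparr>)"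
    (is "cycle_graph n (with_proj ?C)")
proof -
  have fin: "finite (parcs ?C)"
    by (rule finite_subset[of _ "{..<n} \<times> {..<n}"]) auto
  have noloop: "i < n \<Longrightarrow> Suc i mod n \<noteq> i" for i
    using assms by (cases "Suc i = n") auto
  interpret pair_graph ?C
    using fin by unfold_locales (auto simp: symmetric_def sym_def dest: noloop)
  have "graph (with_proj ?C)" by intro_locales
  then show ?thesis
    unfolding cycle_graph_def by (auto intro!: exI[of _ id])
qed

end

(*
  The distance of the i-th and j-th vertex of a cycle is min(|i - j|, n - |i - j|), so at most two
  vertices share their distance to a given one and no k-antiresolving set has k > 2.  Conversely,
  the fixed points of the reflection i -> -i modulo n form a 2-antiresolving set: the reflection
  pairs off the remaining vertices.
*)
theory Submission
  imports Defs
begin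

text \<open>With unit costs the library distance is an infimum of walk lengths in
  \<open>ereal\<close>, so a walk of length \<open>d\<close> together with a lower bound over all
  walks pins it down.\<close>

lemma (in wf_digraph) graph_dist_eqI:
  assumes "awalk u p v" and "length p = d"
    and "\<And>q. awalk u q v \<Longrightarrow> d \<le> length q"
  shows "graph_dist G u v = ereal (real d)"
proof -
  have cost: "awalk_cost (\<lambda>_. 1) q = real (length q)" for q
    by (induction q) auto
  have "graph_dist G u v = (INF q\<in>{q. awalk u q v}. ereal (real (length q)))"
    by (simp add: graph_dist_def \<mu>_def cost)
  also have "\<dots> = ereal (real d)"
    using assms by (intro antisym INF_greatest INF_lower2[where i = p]) auto
  finally show ?thesis .
qed

text \<open>The case split stands for an absolute value, since subtraction on \<open>nat\<close>
  truncates.\<close>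

definition cyclic_dist :: "nat \<Rightarrow> nat \<Rightarrow> nat \<Rightarrow> nat" where
  "cyclic_dist n i j = (let k = (if i \<le> j then j - i else i - j) in min k (n - k))"

text \<open>The Lipschitz bound behind the induction that bounds walk lengths from below.\<close>

lemma cyclic_dist_Suc_le:
  assumes "i < n" and "j < n" and "k < n"
    and "j = (i + 1) mod n \<or> i = (j + 1) mod n"
  shows "cyclic_dist n i k \<le> Suc (cyclic_dist n j k)"
proof -
  have "(i + 1) mod n = (if i + 1 = n then 0 else i + 1)"
    and "(j + 1) mod n = (if j + 1 = n then 0 else j + 1)"
    using assms by auto
  then show ?thesis
    using assms by (auto simp: cyclic_dist_def Let_def min_def split: if_splits)
qed

text \<open>Such \<open>i\<close> and \<open>j\<close> are mirror images about \<open>a\<close>, so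
  i + j is congruent to 2a modulo n. Both sides lie below 2n, which leaves the differences 0, n and
  -n.\<close>

lemma cyclic_dist_eq_imp:
  assumes "i < n" and "j < n" and "a < n"
    and "cyclic_dist n j a = cyclic_dist n i a" and "j \<noteq> i"
  shows "i + j = 2 * a \<or> i + j = 2 * a + n \<or> i + j + n = 2 * a"
  using assms unfolding cyclic_dist_def Let_def min_def
  by (simp split: if_splits; linarith)

text \<open>Both \<open>j\<close> and \<open>k\<close> are congruent to 2a - i modulo n, and both
  lie below n.\<close>

lemma cyclic_dist_eq_unique:
  assumes "i < n" and "j < n" and "k < n" and "a < n"
    and "cyclic_dist n j a = cyclic_dist n i a" and "cyclic_dist n k a = cyclic_dist n i a"
    and "j \<noteq> i" and "k \<noteq> i"
  shows "j = k"
  using cyclic_dist_eq_imp[of i n j a] cyclic_dist_eq_imp[of i n k a] assms by linarith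

lemma cyclic_dist_reflect_0:
  "0 < i \<Longrightarrow> i < n \<Longrightarrow> cyclic_dist n (n - i) 0 = cyclic_dist n i 0"
  by (auto simp: cyclic_dist_def Let_def min_def)

lemma cyclic_dist_reflect_half:
  "0 < i \<Longrightarrow> i < 2 * m \<Longrightarrow> cyclic_dist (2 * m) (2 * m - i) m = cyclic_dist (2 * m) i m"
  by (auto simp: cyclic_dist_def Let_def min_def)

locale enumerated_cycle = graph G for G :: "('a, 'b) pre_digraph" (structure) +
  fixes f :: "nat \<Rightarrow> 'a" and n :: nat
  assumes n_ge_3: "n \<ge> 3"
    and bij: "bij_betw f {..<n} (verts G)"
    and arcs_ends_eq: "arcs_ends G = {(f i, f j) | i j. i < n \<and> j < n \<and>
                         (j = (i + 1) mod n \<or> i = (j + 1) mod n)}"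
begin

lemma f_inject: "i < n \<Longrightarrow> j < n \<Longrightarrow> f i = f j \<longleftrightarrow> i = j"
  using bij by (auto simp: bij_betw_def inj_on_def)

lemma verts_eq: "verts G = f ` {..<n}"
  using bij by (simp add: bij_betw_def)

lemma awalk_step:
  assumes "i < n" and "j < n" and "j = (i + 1) mod n \<or> i = (j + 1) mod n"
    and "awalk (f j) p v"
  shows "\<exists>q. awalk (f i) q v \<and> length q = Suc (length p)"
proof -
  have "(f i, f j) \<in> arcs_ends G"
    using assms(1-3) unfolding arcs_ends_eq by blast
  then obtain e where "e \<in> arcs G" "tail G e = f i" "head G e = f j"
    \<comment> \<open>Here \<open>reachableE\<close> is applied to a single adjacency and yields an
      arc realizing it.\<close>
    by (rule reachableE)
  then have "awalk (f i) (e # p) v"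
    using assms(4) by (simp add: awalk_Cons_iff)
  then show ?thesis by (intro exI[of _ "e # p"]) simp
qed

text \<open>Reducing indices modulo n lets walks wrap around. Arcs are prepended, which moves the
  start, so the induction needs all \<open>i\<close>.\<close>

lemma awalk_forward: "\<exists>p. awalk (f (i mod n)) p (f ((i + k) mod n)) \<and> length p = k"
proof (induction k arbitrary: i)
  case 0
  have "f (i mod n) \<in> verts G" using n_ge_3 by (auto simp: verts_eq)
  then show ?case by (auto simp: awalk_Nil_iff)
next
  case (Suc k)
  obtain p where "awalk (f (Suc i mod n)) p (f ((Suc i + k) mod n))" "length p = k"
    using Suc by blast
  then show ?case
    using awalk_step[of "i mod n" "Suc i mod n" p] n_ge_3 by (auto simp: mod_Suc_eq)
qed

text \<open>Here prepending an arc moves the start from i + k to i + k + 1, and the end stays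
  fixed.\<close>

lemma awalk_backward: "\<exists>p. awalk (f ((i + k) mod n)) p (f (i mod n)) \<and> length p = k"
proof (induction k)
  case 0
  have "f (i mod n) \<in> verts G" using n_ge_3 by (auto simp: verts_eq)
  then show ?case by (auto simp: awalk_Nil_iff)
next
  case (Suc k)
  then obtain p where "awalk (f ((i + k) mod n)) p (f (i mod n))" "length p = k"
    by blast
  then show ?case
    using awalk_step[of "(i + Suc k) mod n" "(i + k) mod n" p] n_ge_3 by (auto simp: mod_Suc_eq)
qed

lemma awalk_cyclic_dist:
  assumes "i < n" and "j < n"
  shows "\<exists>p. awalk (f i) p (f j) \<and> length p = cyclic_dist n i j"
proof (cases "i \<le> j")
  case True
  then show ?thesis
    \<comment> \<open>These are the two ways around the cycle; the second starts at \<open>i\<close>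
      because j + (n - (j - i)) = n + i.\<close>
    using assms awalk_forward[of i "j - i"] awalk_backward[of j "n - (j - i)"]
    by (auto simp: cyclic_dist_def Let_def min_def)
next
  case False
  then show ?thesis
    using assms awalk_backward[of j "i - j"] awalk_forward[of i "n - (i - j)"]
    by (auto simp: cyclic_dist_def Let_def min_def)
qed

text \<open>Each arc of the walk lowers the cyclic distance to \<open>j\<close> by at most
  one.\<close>

lemma cyclic_dist_le_length:
  "awalk (f i) p (f j) \<Longrightarrow> i < n \<Longrightarrow> j < n \<Longrightarrow> cyclic_dist n i j \<le> length p"
proof (induction p arbitrary: i)
  case Nil
  then show ?case by (simp add: awalk_Nil_iff f_inject cyclic_dist_def)
next
  case (Cons e p)
  from Cons.prems have e: "e \<in> arcs G" "f i = tail G e" "awalk (head G e) p (f j)"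
    by (simp_all add: awalk_Cons_iff)
  then have "(f i, head G e) \<in> arcs_ends G"
    by (simp add: in_arcs_imp_in_arcs_ends)
  then obtain i' k where k: "f i = f i'" "head G e = f k" "i' < n" "k < n"
      "k = (i' + 1) mod n \<or> i' = (k + 1) mod n"
    unfolding arcs_ends_eq by blast
  have "i' = i" using k(1,3) Cons.prems(2) by (simp add: f_inject)
  then have "cyclic_dist n i j \<le> Suc (cyclic_dist n k j)"
    using k(3-5) Cons.prems(3) by (intro cyclic_dist_Suc_le) simp_all
  moreover have "cyclic_dist n k j \<le> length p"
    using e(3) k(2,4) Cons.prems(3) by (intro Cons.IH) simp_all
  ultimately show ?case by simp
qed

lemma graph_dist_eq:
  assumes "i < n" and "j < n"
  shows "graph_dist G (f i) (f j) = ereal (real (cyclic_dist n i j))"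
  using awalk_cyclic_dist[OF assms] graph_dist_eqI cyclic_dist_le_length assms by blast

lemma connected: "connected G"
proof -
  have "u \<rightarrow>\<^sup>* v" if uv: "u \<in> verts G" "v \<in> verts G" for u v
  proof -
    obtain i j where "u = f i" "i < n" "v = f j" "j < n"
      using uv unfolding verts_eq by blast
    then show ?thesis
      using awalk_cyclic_dist[of i j] by (auto simp: reachable_awalk)
  qed
  moreover have "verts G \<noteq> {}" using n_ge_3 by (auto simp: verts_eq lessThan_empty_iff)
  ultimately show ?thesis
    \<comment> \<open>The library defines \<open>connected\<close> through the symmetric closure,
      whose reachability agrees with that of the symmetric \<open>G\<close>.\<close>
    by (auto simp: connected_def strongly_connected_def reachable_mk_symmetric_eq[OF sym_arcs])
qed

text \<open>The first entry of \<open>us\<close> already decides: equal representations give equal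
  distances to it, so a vertex has at most one twin.\<close>

lemma twins_at_least_le_2:
  assumes "us \<noteq> []" and "set us \<subset> verts G" and "twins_at_least G us k"
  shows "k \<le> 2"
proof -
  obtain a where a: "a < n" "hd us = f a"
    using assms(1,2) hd_in_set[of us] unfolding verts_eq by blast
  \<comment> \<open>Properness supplies a vertex outside \<open>us\<close>, so the twin condition is
    not vacuous.\<close>
  obtain i where i: "i < n" "f i \<in> verts G - set us"
    using assms(2) by (auto simp: verts_eq)
  let ?T = "{w \<in> verts G - set us. w \<noteq> f i \<and> metric_rep G us w = metric_rep G us (f i)}"
  have fin: "finite ?T"
    by (rule finite_subset[OF _ finite_verts]) blast
  have hd_dist: "graph_dist G w (hd us) = graph_dist G (f i) (hd us)" if "w \<in> ?T" for w
    using that assms(1) by (auto simp: metric_rep_def)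
  have "x = y" if xy: "x \<in> ?T" "y \<in> ?T" for x y
  proof -
    obtain j k where jk: "x = f j" "j < n" "y = f k" "k < n"
      using xy by (auto simp: verts_eq)
    then have "cyclic_dist n j a = cyclic_dist n i a" "cyclic_dist n k a = cyclic_dist n i a"
      using hd_dist[OF xy(1)] hd_dist[OF xy(2)] a i(1) by (simp_all add: graph_dist_eq)
    moreover have "j \<noteq> i" "k \<noteq> i" using xy jk by auto
    ultimately show "x = y" using cyclic_dist_eq_unique jk i(1) a(1) by blast
  qed
  then have "card ?T \<le> Suc 0"
    using card_le_Suc0_iff_eq[OF fin] by blast
  moreover have "k - 1 \<le> card ?T"
    using assms(3) i(2) by (simp add: twins_at_least_def)
  ultimately show ?thesis by simp
qed

text \<open>For even n the vertex n/2 must join the set: it is the only one farthest from 0 and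
  would have no twin.\<close>

lemma antiresolving_set_fixed_points:
  defines "ix \<equiv> if even n then [0, n div 2] else [0]"
  shows "antiresolving_set G 2 (map f ix)"
proof -
  have ix_less: "set ix \<subseteq> {..<n}" using n_ge_3 by (auto simp: ix_def)
  have mem: "f i \<in> set (map f ix) \<longleftrightarrow> i \<in> set ix" if "i < n" for i
    using that ix_less by (auto simp: f_inject subset_iff)
  have "distinct (map f ix)" using n_ge_3 by (auto simp: ix_def f_inject)
  moreover have ne: "map f ix \<noteq> []" by (simp add: ix_def)
  moreover have sub: "set (map f ix) \<subset> verts G"
  proof
    show "set (map f ix) \<subseteq> verts G" using ix_less by (auto simp: verts_eq)
    \<comment> \<open>For even n the bound n \<ge> 3 gives n div 2 \<ge> 2, so \<open>f 1\<close>
      witnesses properness.\<close>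
    have "1 \<notin> set ix" using n_ge_3 by (auto simp: ix_def)
    then have "f 1 \<notin> set (map f ix)" using mem[of 1] n_ge_3 by simp
    moreover have "f 1 \<in> verts G" using n_ge_3 by (simp add: verts_eq)
    ultimately show "set (map f ix) \<noteq> verts G" by blast
  qed
  moreover have "twins_at_least G (map f ix) 2"
    unfolding twins_at_least_def
  proof
    fix v assume v: "v \<in> verts G - set (map f ix)"
    let ?T = "{w \<in> verts G - set (map f ix). w \<noteq> v \<and>
                metric_rep G (map f ix) w = metric_rep G (map f ix) v}"
    obtain i where i: "v = f i" "i < n" "i \<notin> set ix"
      using v mem by (auto simp: verts_eq)
    \<comment> \<open>So the mirror index n - i is a valid index and differs from
      \<open>i\<close>.\<close>
    have "i \<noteq> 0" "2 * i \<noteq> n"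
      using i(3) by (auto simp: ix_def split: if_splits)
    then have refl: "n - i < n" "n - i \<noteq> i" "n - i \<notin> set ix"
      using i(2) by (auto simp: ix_def)
    have "cyclic_dist n (n - i) a = cyclic_dist n i a" if "a \<in> set ix" for a
      using that i(2,3) cyclic_dist_reflect_0[of i n] cyclic_dist_reflect_half[of i "n div 2"]
      by (auto simp: ix_def split: if_splits)
    then have "metric_rep G (map f ix) (f (n - i)) = metric_rep G (map f ix) v"
      using i refl(1) ix_less by (auto simp: metric_rep_def graph_dist_eq subset_iff)
    then have "f (n - i) \<in> ?T"
      using refl i mem[of "n - i"] f_inject[of "n - i" i] by (auto simp: verts_eq)
    moreover have "finite ?T"
      by (rule finite_subset[OF _ finite_verts]) blast
    ultimately have "card ?T > 0" by (metis (no_types, lifting) card_gt_0_iff empty_iff)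
    then show "2 - 1 \<le> card ?T" by simp
  qed
  ultimately show ?thesis
    \<comment> \<open>The general upper bound also shows that 2 is the greatest value for this
      set.\<close>
    unfolding antiresolving_set_def using twins_at_least_le_2[OF ne sub] by auto
qed

end

theorem mainTheorem9:
  fixes G :: "('a, 'b) pre_digraph" and n :: nat
  assumes "n \<ge> 3" and "cycle_graph n G"
  shows "metric_antidimensional G 2"
proof -
  obtain f where "graph G" "bij_betw f {..<n} (verts G)"
      "arcs_ends G = {(f i, f j) | i j. i < n \<and> j < n \<and>
                        (j = (i + 1) mod n \<or> i = (j + 1) mod n)}"
    using assms(2) unfolding cycle_graph_def by blast
  then interpret enumerated_cycle G f n
    using assms(1) by (intro enumerated_cycle.intro enumerated_cycle_axioms.intro)
  show ?thesis
    unfolding metric_antidimensional_def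
  proof (intro conjI allI impI)
    show "\<exists>us. antiresolving_set G 2 us"
      using antiresolving_set_fixed_points by blast
    show "j \<le> 2" if "antiresolving_set G j us" for j us
      using that twins_at_least_le_2 by (auto simp: antiresolving_set_def)
  qed (fact \<open>graph G\<close> connected)+
qed

end
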